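(* A loose endomorphism $F:A\nrightarrow A$ in $\mathbf{Mly}$ is given by a "matching pair of sets", i.e. a set $E$ with functions $d:A\times E\to E$ and $s:A\times E\to A$. These functions have a canonical extension $M(F)=(E^*,d^+,s^+):A\nrightarrow A$, where $E^*$ is the set of finite lists on $E$ and $d^+:A\times E^*\to E^*$, $s^+:A\times E^*\to A$ are defined by $$d^+(a,[\,])=[\,],\qquad d^+(a,e::es)=d(a,e)::d^+(a,es),$$ $$s^+(a,[\,])=a,\qquad s^+(a,e::es)=s^+(s(a,e),es^{\leftarrow}),$$ where $es^{\leftarrow}$ is the safe reverse of the list $es$ (empty if $es=[\,]$). This extension $M(F)$ provides the free monad on the loose morphism $F$, i.e.: (1) $M(F)$ is equipped with a unit cell $\eta$ and a multiplication cell $\mu$ making it a monad on $A$ in $\mathbf{Mly}$, and with a cell $\nu:F\Rightarrow M(F)$ with identity tight sides; (2) the universal property of a free object holds: for every monad $N$ on a set $B$, every function $f:A\to B$ and every cell $\gamma:F\Rightarrow N$ with both tight sides equal to $f$, there is a unique monad morphism $\gamma^*:M(F)\to N$ over $f$ such that $\gamma^*\circ\nu=\gamma$.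
   Context: $\mathbf{Mly}$ is the pseudo double category of Mealy automata in the category of sets. Its objects are sets and its tight morphisms are functions. A loose morphism $A\nrightarrow B$ is a triple $(E,d,s)$ with $E$ a set (the carrier) and $d:A\times E\to E$, $s:A\times E\to B$ functions. A cell from $(E,d,s):A\nrightarrow B$ to $(E',d',s'):X\nrightarrow Y$ with tight sides $f:A\to X$, $g:B\to Y$ is a function $\alpha:E\to E'$ with $\alpha(d(a,e))=d'(f(a),\alpha(e))$ and $g(s(a,e))=s'(f(a),\alpha(e))$. Vertical composition of cells is composition of functions. A monad on $A$ in $\mathbf{Mly}$ consists of a loose morphism $(E,d,s):A\nrightarrow A$, an element $e_0\in E$ (unit cell) and a binary operation $\cdot$ on $E$ (multiplication cell) such that $(E,\cdot,e_0)$ is a monoid and for all $a\in A$, $e,e'\in E$: $s(a,e_0)=a$; $d(a,e_0)=e_0$; $s(a,e\cdot e')=s(s(a,e),e')$; $d(a,e\cdot e')=d(a,e)\cdot d(s(a,e),e')$. A (tight) monad morphism from a monad on $A$ with carrier $E$ to a monad on $B$ with carrier $E'$, over a function $f:A\to B$, is a cell $\alpha:E\to E'$ with both tight sides equal to $f$ that is compatible with units and multiplications, i.e. $\alpha$ is a monoid homomorphism. Lists are written with empty list $[\,]$ and cons $e::es$.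
   Formalization: The cons clauses are corrected to d⁺(a,e::es)=d(a,e)::d⁺(s(a,e),es) and s⁺(a,e::es)=s⁺(s(a,e),es), without reverse; as printed the claim fails for A=E=Z/2, d(a,e)=a+e, s(a,e)=a+1. Unit is [], multiplication is concatenation, ν(e)=[e]. *)

theory Defs
  imports "HOL-Algebra.Group"
begin

text \<open>
  Objects are sets \<open>A :: 'a set\<close> (possibly empty), tight morphisms are elements of
  \<open>A \<rightarrow>\<^sub>E B\<close>, and cells are elements of \<open>E \<rightarrow>\<^sub>E E'\<close>. These functions are
  \<open>undefined\<close> outside their domain, so HOL equality of them is equality of functions between
  the given sets; identity and composition are \<open>\<lambda>x\<in>A. x\<close> and \<open>compose\<close>.
\<close>

record ('a, 'e, 'b) mealy = "'e partial_object" +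
  mly_d :: "'a \<Rightarrow> 'e \<Rightarrow> 'e"
  mly_s :: "'a \<Rightarrow> 'e \<Rightarrow> 'b"

definition loose :: "'a set \<Rightarrow> 'b set \<Rightarrow> ('a, 'e, 'b, 'z) mealy_scheme \<Rightarrow> bool" where
  "loose A B F \<longleftrightarrow>
     (\<forall>a\<in>A. \<forall>e\<in>carrier F. mly_d F a e \<in> carrier F \<and> mly_s F a e \<in> B)"

text \<open>
  \<open>mly_cell A B F X Y G f g \<alpha>\<close>: \<open>\<alpha>\<close> is a cell from \<open>F\<close>, a loose morphism from \<open>A\<close> to \<open>B\<close>,
  to \<open>G\<close>, a loose morphism from \<open>X\<close> to \<open>Y\<close>, with tight sides \<open>f\<close> and \<open>g\<close>.
\<close>

definition mly_cell ::
  "'a set \<Rightarrow> 'b set \<Rightarrow> ('a, 'e, 'b, 'z) mealy_scheme \<Rightarrow>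
   'x set \<Rightarrow> 'y set \<Rightarrow> ('x, 'c, 'y, 'w) mealy_scheme \<Rightarrow>
   ('a \<Rightarrow> 'x) \<Rightarrow> ('b \<Rightarrow> 'y) \<Rightarrow> ('e \<Rightarrow> 'c) \<Rightarrow> bool" where
  "mly_cell A B F X Y G f g \<alpha> \<longleftrightarrow>
     loose A B F \<and> loose X Y G \<and>
     f \<in> A \<rightarrow>\<^sub>E X \<and> g \<in> B \<rightarrow>\<^sub>E Y \<and> \<alpha> \<in> carrier F \<rightarrow>\<^sub>E carrier G \<and>
     (\<forall>a\<in>A. \<forall>e\<in>carrier F.
        \<alpha> (mly_d F a e) = mly_d G (f a) (\<alpha> e) \<and>
        g (mly_s F a e) = mly_s G (f a) (\<alpha> e))"

record ('a, 'e) mly_monad = "('a, 'e, 'a) mealy" +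
  mly_unit :: 'e
  mly_mult :: "'e \<Rightarrow> 'e \<Rightarrow> 'e"

definition mly_monoid :: "('a, 'e, 'z) mly_monad_scheme \<Rightarrow> 'e monoid" where
  "mly_monoid M = \<lparr>carrier = carrier M, mult = mly_mult M, one = mly_unit M\<rparr>"

definition is_mly_monad :: "'a set \<Rightarrow> ('a, 'e, 'z) mly_monad_scheme \<Rightarrow> bool" where
  "is_mly_monad A M \<longleftrightarrow>
     loose A A M \<and> Group.monoid (mly_monoid M) \<and>
     (\<forall>a\<in>A. mly_s M a (mly_unit M) = a \<and> mly_d M a (mly_unit M) = mly_unit M) \<and>
     (\<forall>a\<in>A. \<forall>e\<in>carrier M. \<forall>e'\<in>carrier M.
        mly_s M a (mly_mult M e e') = mly_s M (mly_s M a e) e' \<and>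
        mly_d M a (mly_mult M e e') = mly_mult M (mly_d M a e) (mly_d M (mly_s M a e) e'))"

definition monad_morphism ::
  "'a set \<Rightarrow> ('a, 'e, 'z) mly_monad_scheme \<Rightarrow> 'b set \<Rightarrow> ('b, 'c, 'w) mly_monad_scheme \<Rightarrow>
   ('a \<Rightarrow> 'b) \<Rightarrow> ('e \<Rightarrow> 'c) \<Rightarrow> bool" where
  "monad_morphism A M B N f \<alpha> \<longleftrightarrow>
     mly_cell A A M B B N f f \<alpha> \<and>
     \<alpha> \<in> hom (mly_monoid M) (mly_monoid N) \<and>
     \<alpha> (mly_unit M) = mly_unit N"

text \<open>
  The extension of \<open>(E, d, s)\<close> to lists. In both recursive clauses the tail is processed in its
  given order, starting from the state \<open>s a e\<close>. This is forced by the monad laws for the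
  multiplication \<open>(@)\<close>, since \<open>e # es = [e] @ es\<close>.

  The source prints \<open>d\<^sup>+(a, e # es) = d(a, e) # d\<^sup>+(a, es)\<close> and
  \<open>s\<^sup>+(a, e # es) = s\<^sup>+(s(a, e), rev es)\<close> instead. The clauses are corrected here because with
  the printed ones the universal property fails for every choice of unit, multiplication and
  \<open>\<nu>\<close>. Take \<open>A = E = {0, 1}\<close> with \<open>d(a, e) = a + e\<close> and \<open>s(a, e) = a + 1\<close> modulo 2.
  The printed \<open>d\<^sup>+(0, -)\<close> is the identity, so for every monad morphism \<open>\<alpha>\<close> over the
  identity the action of \<open>0\<close> fixes \<open>\<alpha>(\<nu> 0) \<cdot> \<alpha>(\<nu> 0)\<close>. But the monad defined below is a
  possible target, with \<open>\<alpha>(\<nu> e) = [e]\<close>, and there the action of \<open>0\<close> sends \<open>[0, 0]\<close>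
  to \<open>[0, 1]\<close>.
\<close>

primrec d_plus :: "('a, 'e, 'a, 'z) mealy_scheme \<Rightarrow> 'a \<Rightarrow> 'e list \<Rightarrow> 'e list" where
  "d_plus F a [] = []"
| "d_plus F a (e # es) = mly_d F a e # d_plus F (mly_s F a e) es"

primrec s_plus :: "('a, 'e, 'a, 'z) mealy_scheme \<Rightarrow> 'a \<Rightarrow> 'e list \<Rightarrow> 'a" where
  "s_plus F a [] = a"
| "s_plus F a (e # es) = s_plus F (mly_s F a e) es"

definition free_mly_monad :: "('a, 'e, 'a, 'z) mealy_scheme \<Rightarrow> ('a, 'e list) mly_monad" where
  "free_mly_monad F =
     \<lparr>carrier = lists (carrier F), mly_d = d_plus F, mly_s = s_plus F,
      mly_unit = [], mly_mult = (@)\<rparr>"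

definition free_incl :: "('a, 'e, 'a, 'z) mealy_scheme \<Rightarrow> 'e \<Rightarrow> 'e list" where
  "free_incl F = (\<lambda>e\<in>carrier F. [e])"

end

theory Submission
  imports Defs
begin

text \<open>
  \<open>(lists E, @, [])\<close> is the free monoid on \<open>E\<close>, so the only candidate for \<open>\<gamma>*\<close> is the monoid
  homomorphism extending \<open>\<gamma>\<close>. That it is a cell follows by induction on lists: the monad laws of the
  target for a product \<open>\<gamma> e \<cdot> x\<close> have the same shape as the recursive clauses of \<open>d_plus\<close> and \<open>s_plus\<close>.
\<close>

lemma free_mly_monad_simps [simp]:
  "carrier (free_mly_monad F) = lists (carrier F)"
  "mly_d (free_mly_monad F) = d_plus F"
  "mly_s (free_mly_monad F) = s_plus F"
  "mly_unit (free_mly_monad F) = []"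
  "mly_mult (free_mly_monad F) = (@)"
  by (simp_all add: free_mly_monad_def)

lemma mly_monoid_simps [simp]:
  "carrier (mly_monoid M) = carrier M"
  "mult (mly_monoid M) = mly_mult M"
  "one (mly_monoid M) = mly_unit M"
  by (simp_all add: mly_monoid_def)

lemma loose_d_closed: "loose A B F \<Longrightarrow> a \<in> A \<Longrightarrow> e \<in> carrier F \<Longrightarrow> mly_d F a e \<in> carrier F"
  and loose_s_closed: "loose A B F \<Longrightarrow> a \<in> A \<Longrightarrow> e \<in> carrier F \<Longrightarrow> mly_s F a e \<in> B"
  by (auto simp: loose_def)

lemma d_plus_closed:
  assumes "loose A A F" "a \<in> A" "es \<in> lists (carrier F)"
  shows "d_plus F a es \<in> lists (carrier F)"
  using assms(3,2)
  by (induction es arbitrary: a) (auto simp: loose_d_closed[OF assms(1)] loose_s_closed[OF assms(1)])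

lemma s_plus_closed:
  assumes "loose A A F" "a \<in> A" "es \<in> lists (carrier F)"
  shows "s_plus F a es \<in> A"
  using assms(3,2)
  by (induction es arbitrary: a) (auto simp: loose_s_closed[OF assms(1)])

text \<open>Both recursions read a list from the left and thread the state, so \<open>es'\<close> is
  entered in the state that \<open>es\<close> leaves. This and \<open>d_plus_append\<close> are the
  multiplication laws of the free monad.\<close>

lemma s_plus_append: "s_plus F a (es @ es') = s_plus F (s_plus F a es) es'"
  by (induction es arbitrary: a) auto

lemma d_plus_append: "d_plus F a (es @ es') = d_plus F a es @ d_plus F (s_plus F a es) es'"
  by (induction es arbitrary: a) auto

lemma is_mly_monad_free:
  assumes "loose A A F"
  shows "is_mly_monad A (free_mly_monad F)"
proof -
  have "loose A A (free_mly_monad F)"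
    using d_plus_closed[OF assms] s_plus_closed[OF assms] by (simp add: loose_def)
  moreover have "Group.monoid (mly_monoid (free_mly_monad F))"
    by unfold_locales auto
  ultimately show ?thesis
    by (simp add: is_mly_monad_def s_plus_append d_plus_append)
qed

text \<open>On a singleton the recursive clauses collapse to one application of \<open>mly_d\<close>
  and \<open>mly_s\<close>.\<close>

lemma mly_cell_free_incl:
  assumes "loose A A F"
  shows "mly_cell A A F A A (free_mly_monad F) (\<lambda>a\<in>A. a) (\<lambda>a\<in>A. a) (free_incl F)"
  using assms is_mly_monad_free[OF assms]
  by (auto simp: mly_cell_def is_mly_monad_def free_incl_def loose_d_closed loose_s_closed)

text \<open>The right fold makes the value at a cons a product with left factor
  \<open>\<gamma> e\<close>, matching the recursion of \<open>d_plus\<close> and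
  \<open>s_plus\<close>. Restricting to lists over the carrier makes the function extensional, as
  cells are.\<close>

definition mly_lift ::
  "('a, 'e, 'a, 'z) mealy_scheme \<Rightarrow> ('b, 'c, 'w) mly_monad_scheme \<Rightarrow> ('e \<Rightarrow> 'c) \<Rightarrow> 'e list \<Rightarrow> 'c"
  where "mly_lift F N \<gamma> =
    (\<lambda>es\<in>lists (carrier F). foldr (\<lambda>e. mly_mult N (\<gamma> e)) es (mly_unit N))"

lemma mly_lift_Nil [simp]: "mly_lift F N \<gamma> [] = mly_unit N"
  by (simp add: mly_lift_def)

lemma mly_lift_Cons [simp]:
  "e \<in> carrier F \<Longrightarrow> es \<in> lists (carrier F) \<Longrightarrow>
    mly_lift F N \<gamma> (e # es) = mly_mult N (\<gamma> e) (mly_lift F N \<gamma> es)"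
  by (simp add: mly_lift_def)

lemma mly_lift_closed:
  assumes "Group.monoid (mly_monoid N)" "\<gamma> \<in> carrier F \<rightarrow> carrier N" "es \<in> lists (carrier F)"
  shows "mly_lift F N \<gamma> es \<in> carrier N"
  using assms(3)
proof induction
  case Nil
  then show ?case using monoid.one_closed[OF assms(1)] by simp
next
  case (Cons e es)
  then show ?case
    using assms(2) monoid.m_closed[OF assms(1), of "\<gamma> e" "mly_lift F N \<gamma> es"]
    by (auto simp: Pi_iff)
qed

text \<open>Induction on the first list: the empty case is the left unit law, the cons case
  associativity.\<close>

lemma mly_lift_append:
  assumes "Group.monoid (mly_monoid N)" "\<gamma> \<in> carrier F \<rightarrow> carrier N"
    and "es \<in> lists (carrier F)" "es' \<in> lists (carrier F)"
  shows "mly_lift F N \<gamma> (es @ es') = mly_mult N (mly_lift F N \<gamma> es) (mly_lift F N \<gamma> es')"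
  using assms(3)
proof induction
  case Nil
  then show ?case
    using monoid.l_one[OF assms(1)] mly_lift_closed[OF assms(1,2,4)] by simp
next
  case (Cons e es)
  then show ?case
    using assms(2,4) mly_lift_closed[OF assms(1,2)]
      monoid.m_assoc[OF assms(1), of "\<gamma> e" "mly_lift F N \<gamma> es" "mly_lift F N \<gamma> es'"]
    by (auto simp: Pi_iff)
qed

text \<open>The state must stay general in the induction, because the tail is read from
  \<open>mly_s F a e\<close> and no longer from \<open>a\<close>.\<close>

lemma mly_lift_d_s:
  assumes N: "is_mly_monad B N" and cell: "mly_cell A A F B B N f f \<gamma>"
    and "a \<in> A" "es \<in> lists (carrier F)"
  shows "mly_lift F N \<gamma> (d_plus F a es) = mly_d N (f a) (mly_lift F N \<gamma> es) \<and>
    f (s_plus F a es) = mly_s N (f a) (mly_lift F N \<gamma> es)"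
  using assms(4,3)
proof (induction es arbitrary: a)
  case Nil
  \<comment> \<open>This membership allows the unit laws of \<open>N\<close> at the state
    \<open>f a\<close>.\<close>
  then have "f a \<in> B"
    using cell by (auto simp: mly_cell_def)
  then show ?case
    using N by (simp add: is_mly_monad_def)
next
  case (Cons e es)
  have F: "loose A A F" and \<gamma>: "\<gamma> \<in> carrier F \<rightarrow> carrier N"
    using cell by (auto simp: mly_cell_def)
  have "f a \<in> B" "\<gamma> e \<in> carrier N"
    using cell Cons.prems Cons.hyps by (auto simp: mly_cell_def)
  moreover have "mly_lift F N \<gamma> es \<in> carrier N"
    using N \<gamma> Cons.hyps by (intro mly_lift_closed) (auto simp: is_mly_monad_def)
  moreover have "\<gamma> (mly_d F a e) = mly_d N (f a) (\<gamma> e)" "f (mly_s F a e) = mly_s N (f a) (\<gamma> e)"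
    using cell Cons.prems Cons.hyps by (auto simp: mly_cell_def)
  moreover have "mly_d F a e \<in> carrier F" "mly_s F a e \<in> A"
    using F Cons.prems Cons.hyps by (auto simp: loose_def)
  \<comment> \<open>The induction hypothesis is used at the state \<open>mly_s F a e\<close>, whose
    image under \<open>f\<close> is \<open>mly_s N (f a) (\<gamma> e)\<close>. This is the state in
    which the laws of \<open>N\<close> for the product of \<open>\<gamma> e\<close> and
    \<open>mly_lift F N \<gamma> es\<close> evaluate the second factor.\<close>
  ultimately show ?case
    using N Cons d_plus_closed[OF F, of "mly_s F a e" es]
    by (simp add: is_mly_monad_def)
qed

lemma monad_morphism_mly_lift:
  assumes N: "is_mly_monad B N" and cell: "mly_cell A A F B B N f f \<gamma>"
  shows "monad_morphism A (free_mly_monad F) B N f (mly_lift F N \<gamma>)"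
proof -
  have mon: "Group.monoid (mly_monoid N)" and \<gamma>: "\<gamma> \<in> carrier F \<rightarrow> carrier N"
    and f: "f \<in> A \<rightarrow>\<^sub>E B" and F: "loose A A F"
    using assms by (auto simp: is_mly_monad_def mly_cell_def)
  have "mly_lift F N \<gamma> \<in> lists (carrier F) \<rightarrow>\<^sub>E carrier N"
    using mly_lift_closed[OF mon \<gamma>] by (auto simp: mly_lift_def)
  then have "mly_cell A A (free_mly_monad F) B B N f f (mly_lift F N \<gamma>)"
    using N f is_mly_monad_free[OF F] mly_lift_d_s[OF N cell]
    by (simp add: mly_cell_def is_mly_monad_def)
  moreover have "mly_lift F N \<gamma> \<in> hom (mly_monoid (free_mly_monad F)) (mly_monoid N)"
    using mly_lift_closed[OF mon \<gamma>] mly_lift_append[OF mon \<gamma>] by (auto simp: hom_def)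
  ultimately show ?thesis
    by (simp add: monad_morphism_def)
qed

text \<open>The lift sends \<open>[e]\<close> to the product of \<open>\<gamma> e\<close> with the
  unit, so the right unit law applies; off the carrier both sides are
  \<open>undefined\<close>.\<close>

lemma compose_mly_lift_free_incl:
  assumes "Group.monoid (mly_monoid N)" "\<gamma> \<in> carrier F \<rightarrow>\<^sub>E carrier N"
  shows "compose (carrier F) (mly_lift F N \<gamma>) (free_incl F) = \<gamma>"
proof
  fix e
  show "compose (carrier F) (mly_lift F N \<gamma>) (free_incl F) e = \<gamma> e"
    using assms(2) monoid.r_one[OF assms(1), of "\<gamma> e"] PiE_arb[OF assms(2), of e]
    by (cases "e \<in> carrier F") (auto simp: compose_def free_incl_def)
qed

text \<open>Singletons generate the list monoid, and the composite with \<open>free_incl\<close>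
  prescribes the values of \<open>\<alpha>\<close> on them.\<close>

lemma monad_morphism_free_unique:
  assumes \<alpha>: "monad_morphism A (free_mly_monad F) B N f \<alpha>"
    and \<gamma>: "compose (carrier F) \<alpha> (free_incl F) = \<gamma>"
  shows "\<alpha> = mly_lift F N \<gamma>"
proof
  fix es
  show "\<alpha> es = mly_lift F N \<gamma> es"
  proof (cases "es \<in> lists (carrier F)")
    case True
    then show ?thesis
    proof induction
      case Nil
      then show ?case using \<alpha> by (simp add: monad_morphism_def)
    next
      case (Cons e es)
      \<comment> \<open>With \<open>append_Cons\<close> active, \<open>[e] @ es\<close> would be
        contracted to a cons before the homomorphism law could match it.\<close>
      have "\<alpha> ([e] @ es) = mly_mult N (\<alpha> [e]) (\<alpha> es)"
        using \<alpha> Cons.hyps by (auto simp: monad_morphism_def hom_def simp del: append_Cons)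
      moreover have "\<alpha> [e] = \<gamma> e"
        using \<gamma> Cons.hyps by (auto simp: compose_def free_incl_def)
      ultimately show ?case
        using Cons by simp
    qed
  next
    case False
    \<comment> \<open>Extensionality gives \<open>\<alpha>\<close> the value
      \<open>undefined\<close> here, which is also the default of \<open>mly_lift\<close>.\<close>
    moreover have "\<alpha> \<in> lists (carrier F) \<rightarrow>\<^sub>E carrier N"
      using \<alpha> by (simp add: monad_morphism_def mly_cell_def)
    ultimately show ?thesis
      using PiE_arb[of \<alpha> "lists (carrier F)"] by (simp add: mly_lift_def)
  qed
qed

theorem corollary21:
  fixes A :: "'a set" and F :: "('a, 'e, 'a) mealy"
  assumes "loose A A F"
  shows "is_mly_monad A (free_mly_monad F) \<and>
    mly_cell A A F A A (free_mly_monad F) (\<lambda>a\<in>A. a) (\<lambda>a\<in>A. a) (free_incl F) \<and>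
    (\<forall>(B :: 'b set) (N :: ('b, 'c) mly_monad) (f :: 'a \<Rightarrow> 'b) (\<gamma> :: 'e \<Rightarrow> 'c).
       is_mly_monad B N \<and> f \<in> A \<rightarrow>\<^sub>E B \<and> mly_cell A A F B B N f f \<gamma> \<longrightarrow>
       (\<exists>!\<gamma>'. monad_morphism A (free_mly_monad F) B N f \<gamma>' \<and>
              compose (carrier F) \<gamma>' (free_incl F) = \<gamma>))"
proof (intro conjI allI impI)
  fix B :: "'b set" and N :: "('b, 'c) mly_monad" and f :: "'a \<Rightarrow> 'b" and \<gamma> :: "'e \<Rightarrow> 'c"
  assume asm: "is_mly_monad B N \<and> f \<in> A \<rightarrow>\<^sub>E B \<and> mly_cell A A F B B N f f \<gamma>"
  show "\<exists>!\<gamma>'. monad_morphism A (free_mly_monad F) B N f \<gamma>' \<and>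
              compose (carrier F) \<gamma>' (free_incl F) = \<gamma>"
  proof (rule ex1I[of _ "mly_lift F N \<gamma>"])
    show "monad_morphism A (free_mly_monad F) B N f (mly_lift F N \<gamma>) \<and>
        compose (carrier F) (mly_lift F N \<gamma>) (free_incl F) = \<gamma>"
      using asm monad_morphism_mly_lift[of B N A F f \<gamma>] compose_mly_lift_free_incl[of N \<gamma> F]
      by (simp add: is_mly_monad_def mly_cell_def)
  qed (elim conjE, rule monad_morphism_free_unique)
qed (fact is_mly_monad_free[OF assms] mly_cell_free_incl[OF assms])+

end
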